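(* Let $G=(V,E)$ be a finite amply regular $r$-regular graph with polynomial $p(x)=p_2x^2+p_1x+p_0$, and let $C\subset V$ be nonempty. If $\sigma(C)=a$ and $\sigma_2(C)\leq\beta$, then $$|C|\leq \frac{(\beta-p(a))|V|}{p_2(r-a)^2+\beta-p(a)}.$$ If $|C|=\frac{(\beta-p(a))|V|}{p_2(r-a)^2+\beta-p(a)}$, then ${\bf 1}_C$ is a perfect $2$-coloring of $G$.
   Context: Let $M=M(G)$ be the adjacency matrix and $M_2(G)$ the distance-$2$ adjacency matrix (entry $1$ iff the vertices are at graph distance exactly $2$). $G$ is amply regular with polynomial $p$ if $M_2(G)=p(M)=p_2M^2+p_1M+p_0I$; such a graph is $r$-regular with $r=-p_0/p_2$. For $S\subseteq V$, $\sigma(S)=(M{\bf 1}_S,{\bf 1}_S)/|S|$ (average internal degree) and $\sigma_2(S)=(M_2(G){\bf 1}_S,{\bf 1}_S)/|S|$. ${\bf 1}_C$ is a perfect $2$-coloring if the partition $\{C,V\setminus C\}$ is equitable, i.e. there are integers $q_{ij}$ such that every vertex of the $i$-th part has exactly $q_{ij}$ neighbors in the $j$-th part.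
   Formalization: It is additionally assumed that p_2>0 (automatic if some vertices are at distance 2; for disjoint unions of complete graphs p may be rescaled by a negative factor and the bound can fail) and that the denominator p_2(r-a)^2+β-p(a) is nonzero (otherwise the fraction is 0/0). *)

theory Defs
  imports "HOL-Analysis.Analysis" "HOL-Library.Extended_Nat" "HOL-Computational_Algebra.Polynomial"
begin

text \<open>A finite simple graph is a symmetric irreflexive relation on a finite vertex type
  (so V is \<open>UNIV\<close>). Connectedness is not assumed: vertices in different components are at
  distance \<open>\<infinity>\<close>, as the infimum of the empty set.\<close>

definition gdist :: "('v \<Rightarrow> 'v \<Rightarrow> bool) \<Rightarrow> 'v \<Rightarrow> 'v \<Rightarrow> enat" where
  "gdist E u v = (INF n \<in> {n. (E ^^ n) u v}. enat n)"

definition adj_matrix :: "('v::finite \<Rightarrow> 'v \<Rightarrow> bool) \<Rightarrow> real^'v^'v" where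
  "adj_matrix E = (\<chi> u v. if E u v then 1 else 0)"

definition adj2_matrix :: "('v::finite \<Rightarrow> 'v \<Rightarrow> bool) \<Rightarrow> real^'v^'v" where
  "adj2_matrix E = (\<chi> u v. if gdist E u v = 2 then 1 else 0)"

definition amply_regular :: "('v::finite \<Rightarrow> 'v \<Rightarrow> bool) \<Rightarrow> real \<Rightarrow> real \<Rightarrow> real \<Rightarrow> bool" where
  "amply_regular E p2 p1 p0 \<longleftrightarrow>
     adj2_matrix E = p2 *\<^sub>R (adj_matrix E ** adj_matrix E) + p1 *\<^sub>R adj_matrix E + p0 *\<^sub>R mat 1"

definition regular_graph :: "('v::finite \<Rightarrow> 'v \<Rightarrow> bool) \<Rightarrow> nat \<Rightarrow> bool" where
  "regular_graph E r \<longleftrightarrow> (\<forall>v. card {w. E v w} = r)"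

definition ind_vec :: "'v::finite set \<Rightarrow> real^'v" where
  "ind_vec S = (\<chi> v. indicator S v)"

definition sigma1 :: "('v::finite \<Rightarrow> 'v \<Rightarrow> bool) \<Rightarrow> 'v set \<Rightarrow> real" where
  "sigma1 E S = ((adj_matrix E *v ind_vec S) \<bullet> ind_vec S) / real (card S)"

definition sigma2 :: "('v::finite \<Rightarrow> 'v \<Rightarrow> bool) \<Rightarrow> 'v set \<Rightarrow> real" where
  "sigma2 E S = ((adj2_matrix E *v ind_vec S) \<bullet> ind_vec S) / real (card S)"

definition equitable :: "('v::finite \<Rightarrow> 'v \<Rightarrow> bool) \<Rightarrow> 'v set set \<Rightarrow> bool" where
  "equitable E P \<longleftrightarrow>
     (\<exists>q :: 'v set \<Rightarrow> 'v set \<Rightarrow> int. \<forall>A\<in>P. \<forall>B\<in>P. \<forall>v\<in>A. int (card {w \<in> B. E v w}) = q A B)"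

text \<open>The coloring is the characteristic function of \<open>C\<close>, given here by \<open>C\<close> itself.\<close>

definition perfect_2_coloring :: "('v::finite \<Rightarrow> 'v \<Rightarrow> bool) \<Rightarrow> 'v set \<Rightarrow> bool" where
  "perfect_2_coloring E C \<longleftrightarrow> equitable E {C, UNIV - C}"

text \<open>The sign of the leading coefficient is forced unless the graph is a disjoint union of
  complete graphs, where the distance-2 matrix vanishes and any multiple of an annihilating
  quadratic satisfies the definition.\<close>

lemma amply_regular_leading_coeff_pos:
  assumes "amply_regular E p2 p1 p0" and d: "gdist E u v = 2"
  shows "p2 > 0"
proof -
  have le: "gdist E u v \<le> enat n" if "(E ^^ n) u v" for n
    unfolding gdist_def using that by (auto intro: INF_lower)
  have ne: "u \<noteq> v"
    using le[of 0] d by (auto simp flip: zero_enat_def)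
  have nadj: "\<not> E u v"
  proof
    assume "E u v"
    then have "gdist E u v \<le> enat 1" by (intro le) (auto simp: relcompp_apply)
    then show False using d by (simp add: numeral_eq_enat)
  qed
  have "adj2_matrix E $ u $ v = p2 * (adj_matrix E ** adj_matrix E) $ u $ v"
    using assms(1) ne nadj unfolding amply_regular_def by (simp add: adj_matrix_def mat_def)
  then have "1 = p2 * (adj_matrix E ** adj_matrix E) $ u $ v"
    using d by (simp add: adj2_matrix_def)
  moreover have "(adj_matrix E ** adj_matrix E) $ u $ v \<ge> 0"
    by (auto simp: adj_matrix_def matrix_matrix_mult_def intro!: sum_nonneg)
  ultimately show ?thesis
    by (metis mult_nonpos_nonneg not_less not_one_le_zero)
qed

end

theory Submission
  imports Defs
begin

text \<open>Let \<open>d v\<close> be the number of neighbors of \<open>v\<close> in \<open>C\<close>. Its sum over \<open>C\<close> is \<open>a |C|\<close>, double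
  counting gives the sum \<open>r |C|\<close> over all vertices, and the relation \<open>M\<^sub>2 = p(M)\<close> expresses the
  sum of its squares through \<open>\<sigma>\<^sub>2(C)\<close>. The bound says that the variance of \<open>d\<close> on \<open>C\<close> plus its
  variance on the complement is nonnegative; equality means that both variances vanish, i.e. that
  the partition is equitable.\<close>

definition nbrs_in :: "('v::finite \<Rightarrow> 'v \<Rightarrow> bool) \<Rightarrow> 'v set \<Rightarrow> 'v \<Rightarrow> nat" where
  "nbrs_in E S v = card {w \<in> S. E v w}"

lemma adj_matrix_mult_ind_vec:
  "(adj_matrix E *v ind_vec S) $ v = real (nbrs_in E S v)"
proof -
  have "(adj_matrix E *v ind_vec S) $ v = (\<Sum>w\<in>UNIV. if w \<in> {w \<in> S. E v w} then 1 else 0)"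
    unfolding matrix_vector_mult_def adj_matrix_def ind_vec_def vec_lambda_beta
    by (rule sum.cong) (auto simp: indicator_def)
  also have "\<dots> = real (nbrs_in E S v)"
    by (subst sum.If_cases) (auto simp: nbrs_in_def)
  finally show ?thesis .
qed

lemma inner_ind_vec: "x \<bullet> ind_vec S = (\<Sum>v\<in>S. x $ v)"
proof -
  have "x \<bullet> ind_vec S = (\<Sum>v\<in>UNIV. if v \<in> S then x $ v else 0)"
    unfolding inner_vec_def ind_vec_def vec_lambda_beta
    by (rule sum.cong) (auto simp: indicator_def)
  also have "\<dots> = (\<Sum>v\<in>S. x $ v)"
    by (subst sum.If_cases) auto
  finally show ?thesis .
qed

lemma inner_adj_matrix_commute:
  assumes "symp E"
  shows "(adj_matrix E *v x) \<bullet> y = x \<bullet> (adj_matrix E *v y)"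
proof -
  have "transpose (adj_matrix E) = adj_matrix E"
    using sympD[OF assms] by (auto simp: transpose_def adj_matrix_def vec_eq_iff)
  then show ?thesis
    by (metis dot_lmul_matrix vector_transpose_matrix)
qed

text \<open>Symmetry moves the adjacency matrix from the indicator of \<open>S\<close> to the
  all-ones vector, on which it acts as the scalar \<open>r\<close>.\<close>

lemma sum_nbrs_in_UNIV:
  assumes "symp E" and "regular_graph E r"
  shows "(\<Sum>v\<in>UNIV. real (nbrs_in E S v)) = real r * real (card S)"
proof -
  have "(\<Sum>v\<in>UNIV. real (nbrs_in E S v)) = (adj_matrix E *v ind_vec S) \<bullet> ind_vec UNIV"
    by (simp add: inner_ind_vec adj_matrix_mult_ind_vec)
  also have "\<dots> = (adj_matrix E *v ind_vec UNIV) \<bullet> ind_vec S"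
    by (metis assms(1) inner_adj_matrix_commute inner_commute)
  also have "\<dots> = real r * real (card S)"
    using assms(2) by (simp add: inner_ind_vec adj_matrix_mult_ind_vec nbrs_in_def regular_graph_def)
  finally show ?thesis .
qed

lemma sum_nbrs_in_self:
  assumes "S \<noteq> {}"
  shows "(\<Sum>v\<in>S. real (nbrs_in E S v)) = sigma1 E S * real (card S)"
  using assms by (simp add: sigma1_def inner_ind_vec adj_matrix_mult_ind_vec)

text \<open>With M symmetric, the quadratic form of M^2 at the indicator \<open>x\<close> of
  \<open>S\<close> is the squared norm of M\<open>x\<close>, whose entries are the counts
  \<open>nbrs_in E S v\<close>.\<close>

lemma sigma2_amply_regular:
  fixes E :: "'v::finite \<Rightarrow> 'v \<Rightarrow> bool"
  assumes "symp E" and ar: "amply_regular E p2 p1 p0" and "S \<noteq> {}"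
  shows "sigma2 E S * real (card S) =
    p2 * (\<Sum>v\<in>UNIV. (real (nbrs_in E S v))\<^sup>2) + (p1 * sigma1 E S + p0) * real (card S)"
proof -
  let ?M = "adj_matrix E" and ?x = "ind_vec S"
  have "(?M *v (?M *v ?x)) \<bullet> ?x = (?M *v ?x) \<bullet> (?M *v ?x)"
    using inner_adj_matrix_commute[OF assms(1)] by blast
  also have "\<dots> = (\<Sum>v\<in>UNIV. (real (nbrs_in E S v))\<^sup>2)"
    by (simp add: inner_vec_def adj_matrix_mult_ind_vec power2_eq_square)
  finally have sq: "((?M ** ?M) *v ?x) \<bullet> ?x = (\<Sum>v\<in>UNIV. (real (nbrs_in E S v))\<^sup>2)"
    by (simp add: matrix_vector_mul_assoc)
  have lin: "(?M *v ?x) \<bullet> ?x = sigma1 E S * real (card S)"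
    using assms(3) by (simp add: sigma1_def)
  have one: "?x \<bullet> ?x = real (card S)"
    unfolding inner_ind_vec by (simp add: ind_vec_def)
  have "sigma2 E S * real (card S) = (adj2_matrix E *v ?x) \<bullet> ?x"
    using assms(3) by (simp add: sigma2_def)
  also have "\<dots> = p2 * (((?M ** ?M) *v ?x) \<bullet> ?x) + p1 * ((?M *v ?x) \<bullet> ?x) + p0 * (?x \<bullet> ?x)"
    using ar unfolding amply_regular_def
    by (simp add: matrix_vector_mult_add_rdistrib scaleR_matrix_vector_assoc[symmetric] inner_add_left)
  finally show ?thesis
    by (simp add: sq lin one algebra_simps)
qed

text \<open>The usual variance identity. The mean enters as a product rather than a quotient, so
  that an empty \<open>A\<close> is covered.\<close>

lemma sum_square_deviation:
  fixes f :: "'a \<Rightarrow> real"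
  assumes "(\<Sum>v\<in>A. f v) = m * real (card A)"
  shows "(\<Sum>v\<in>A. (f v - m)\<^sup>2) = (\<Sum>v\<in>A. (f v)\<^sup>2) - m\<^sup>2 * real (card A)"
proof -
  have "(\<Sum>v\<in>A. (f v - m)\<^sup>2) = (\<Sum>v\<in>A. (f v)\<^sup>2) - 2 * m * (\<Sum>v\<in>A. f v) + m\<^sup>2 * real (card A)"
    by (simp add: power2_diff sum.distrib sum_subtractf flip: sum_distrib_left sum_distrib_right)
  then show ?thesis
    by (simp add: assms power2_eq_square)
qed

text \<open>The entry of the quotient matrix is read off at an arbitrarily chosen vertex of the
  part; an empty part imposes no condition.\<close>

lemma equitableI:
  assumes "\<And>A B u v. \<lbrakk>A \<in> P; B \<in> P; u \<in> A; v \<in> A\<rbrakk> \<Longrightarrow> nbrs_in E B u = nbrs_in E B v"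
  shows "equitable E P"
  unfolding equitable_def
proof (intro exI ballI)
  fix A B v assume "A \<in> P" "B \<in> P" "v \<in> A"
  then show "int (card {w \<in> B. E v w}) = int (nbrs_in E B (SOME v. v \<in> A))"
    using assms[of A B v "SOME v. v \<in> A"] someI[of "\<lambda>v. v \<in> A" v] by (simp add: nbrs_in_def)
qed

lemma nbrs_in_Compl:
  assumes "regular_graph E r"
  shows "nbrs_in E (UNIV - S) v = r - nbrs_in E S v"
proof -
  have "{w \<in> UNIV - S. E v w} = {w. E v w} - {w \<in> S. E v w}"
    by auto
  then show ?thesis
    using assms by (simp add: nbrs_in_def regular_graph_def card_Diff_subset subset_eq)
qed

text \<open>By regularity the number of neighbors in \<open>C\<close> determines the number outside,
  so only the counts into \<open>C\<close> matter. The constants are real so that the two means can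
  be inserted directly.\<close>

lemma perfect_2_coloringI:
  assumes "regular_graph E r"
    and "\<And>v. v \<in> C \<Longrightarrow> real (nbrs_in E C v) = a"
    and "\<And>v. v \<notin> C \<Longrightarrow> real (nbrs_in E C v) = b"
  shows "perfect_2_coloring E C"
proof -
  have eq: "nbrs_in E C u = nbrs_in E C v" if "u \<in> C \<longleftrightarrow> v \<in> C" for u v
    using that assms(2,3) by (metis of_nat_eq_iff)
  show ?thesis
    unfolding perfect_2_coloring_def
  proof (rule equitableI)
    fix A B u v
    assume "A \<in> {C, UNIV - C}" "B \<in> {C, UNIV - C}" "u \<in> A" "v \<in> A"
    then show "nbrs_in E B u = nbrs_in E B v"
      using eq[of u v] nbrs_in_Compl[OF assms(1)] by auto
  qed
qed

theorem theorem3: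
  fixes E :: "'v::finite \<Rightarrow> 'v \<Rightarrow> bool"
    and C :: "'v set"
    and p2 p1 p0 a \<beta> :: real
    and r :: nat
  assumes "symp E" and "irreflp E"
    and "amply_regular E p2 p1 p0"
    and "p2 > 0"
    and "regular_graph E r"
    and "C \<noteq> {}"
    and "sigma1 E C = a"
    and "sigma2 E C \<le> \<beta>"
    and "p2 * (real r - a)\<^sup>2 + \<beta> - poly [:p0, p1, p2:] a \<noteq> 0"
  shows "real (card C) \<le> (\<beta> - poly [:p0, p1, p2:] a) * real CARD('v) / (p2 * (real r - a)\<^sup>2 + \<beta> - poly [:p0, p1, p2:] a)
    \<and> (real (card C) = (\<beta> - poly [:p0, p1, p2:] a) * real CARD('v) / (p2 * (real r - a)\<^sup>2 + \<beta> - poly [:p0, p1, p2:] a)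
        \<longrightarrow> perfect_2_coloring E C)"
proof -
  define d where "d v = real (nbrs_in E C v)" for v
  define c where "c = real (card C)"
  define m where "m = real (card (UNIV - C))"
  \<comment> \<open>The mean of \<open>d\<close> on the complement; for \<open>C = UNIV\<close> it is the junk value \<open>0\<close>.\<close>
  define b where "b = (real r - a) * c / m"
  \<comment> \<open>\<open>t\<close> and \<open>D\<close> are the factor in the numerator and the
    denominator of the bound; \<open>s\<close> is \<open>t\<close> with the true
    \<open>sigma2 E C\<close> in place of its upper bound \<beta>.\<close>
  define t where "t = \<beta> - poly [:p0, p1, p2:] a"
  define s where "s = sigma2 E C - poly [:p0, p1, p2:] a"
  define D where "D = p2 * (real r - a)\<^sup>2 + t"
  define W where "W = (\<Sum>v\<in>C. (d v - a)\<^sup>2) + (\<Sum>v\<in>UNIV - C. (d v - b)\<^sup>2)"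
  have c: "c > 0"
    using assms(6) by (simp add: c_def card_gt_0_iff)
  have n: "real CARD('v) = c + m"
    using card_mono[of UNIV C] by (simp add: c_def m_def card_Diff_subset of_nat_diff)
  have split: "(\<Sum>v\<in>UNIV. f v) = (\<Sum>v\<in>C. f v) + (\<Sum>v\<in>UNIV - C. f v)" for f :: "'v \<Rightarrow> real"
    using sum.subset_diff[of C UNIV f] by simp
  have sumC: "(\<Sum>v\<in>C. d v) = a * c"
    using sum_nbrs_in_self[OF assms(6)] assms(7) by (simp add: d_def c_def)
  have sumC': "(\<Sum>v\<in>UNIV - C. d v) = (real r - a) * c"
    using split[of d] sumC sum_nbrs_in_UNIV[OF assms(1,5), of C]
    by (simp add: d_def c_def algebra_simps)
  \<comment> \<open>If the complement is empty, the sum in \<open>sumC'\<close> is 0, so the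
    right-hand side vanishes as well.\<close>
  have bm: "b * m = (real r - a) * c"
  proof (cases "m = 0")
    case True
    then have "UNIV - C = {}"
      by (simp add: m_def)
    then show ?thesis
      using sumC' True by (metis mult_zero_right sum.empty)
  qed (simp add: b_def)
  \<comment> \<open>The term \<open>p2 * a^2 * c\<close> from the mean on \<open>C\<close> joins
    \<open>(p1 * a + p0) * c\<close> to form p(a) times \<open>c\<close>.\<close>
  have W: "p2 * W = c * s - p2 * b\<^sup>2 * m"
  proof -
    let ?Q = "\<Sum>v\<in>UNIV. (d v)\<^sup>2"
    have "W = ?Q - a\<^sup>2 * c - b\<^sup>2 * m"
      using sum_square_deviation[of d C a] sum_square_deviation[of d "UNIV - C" b]
        sumC sumC' bm split[of "\<lambda>v. (d v)\<^sup>2"]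
      by (simp add: W_def c_def m_def)
    then have "p2 * W = p2 * ?Q - p2 * a\<^sup>2 * c - p2 * b\<^sup>2 * m"
      by (simp add: right_diff_distrib)
    moreover have "sigma2 E C * c = p2 * ?Q + (p1 * a + p0) * c"
      using sigma2_amply_regular[OF assms(1,3,6)] assms(7) by (simp add: d_def c_def)
    ultimately show ?thesis
      by (simp add: s_def algebra_simps power2_eq_square)
  qed
  have W0: "W \<ge> 0" and m0: "m \<ge> 0"
    by (auto simp: W_def m_def intro!: add_nonneg_nonneg sum_nonneg)
  have st: "s \<le> t"
    using assms(8) by (simp add: s_def t_def)
  \<comment> \<open>This yields the sign of the denominator: 0 \<le> \<open>s\<close> \<le>
    \<open>t\<close> makes \<open>D\<close> nonnegative, and it is nonzero by hypothesis.\<close>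
  have "c * s \<ge> 0"
  proof -
    have "c * s = p2 * W + p2 * b\<^sup>2 * m"
      using W by simp
    then show ?thesis
      using W0 m0 assms(4) by simp
  qed
  then have "t \<ge> 0"
    using c st by (simp add: zero_le_mult_iff)
  moreover have "D \<noteq> 0"
    using assms(9) by (simp add: D_def t_def)
  ultimately have D: "D > 0"
    using assms(4) by (smt (verit) D_def mult_nonneg_nonneg zero_le_power2)
  \<comment> \<open>The factor \<open>c\<close> completes the square of \<open>(r - a) * c\<close>,
    which equals \<open>b * m\<close>; then \<open>W\<close> eliminates
    \<open>p2 * b^2 * m\<close>.\<close>
  have "c * (t * (c + m) - c * D) = c * t * m - p2 * ((real r - a) * c)\<^sup>2"
    by (simp add: D_def algebra_simps power2_eq_square)
  also have "\<dots> = m * (p2 * W) + c * (t - s) * m"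
    unfolding W bm[symmetric] by (simp add: algebra_simps power2_eq_square)
  finally have key: "c * (t * (c + m) - c * D) = m * (p2 * W) + c * (t - s) * m" .
  have nonneg: "m * (p2 * W) \<ge> 0" "c * (t - s) * m \<ge> 0"
    using W0 m0 c st assms(4) by auto
  then have "c * (t * (c + m) - c * D) \<ge> 0"
    unfolding key by simp
  then have "c * D \<le> t * (c + m)"
    using c by (simp add: zero_le_mult_iff)
  then have bound: "c \<le> t * (c + m) / D"
    using D by (simp add: pos_le_divide_eq)
  have coloring: "perfect_2_coloring E C" if "c = t * (c + m) / D"
  \<comment> \<open>For \<open>m = 0\<close> the identity \<open>key\<close> says nothing about
    \<open>W\<close>, but then \<open>C\<close> is the whole vertex set and regularity
    suffices.\<close>
  proof (cases "m = 0")
    case True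
    then have "C = UNIV"
      by (auto simp: m_def)
    then show ?thesis
      using assms(5) by (intro perfect_2_coloringI[of E r _ "real r"])
        (auto simp: nbrs_in_def regular_graph_def)
  next
    case False
    have "t * (c + m) - c * D = 0"
      using that D by (simp add: field_simps)
    then have "m * (p2 * W) + c * (t - s) * m = 0"
      using key by simp
    then have "m * (p2 * W) = 0"
      using nonneg by linarith
    then have "W = 0"
      using False assms(4) by simp
    then have "(\<Sum>v\<in>C. (d v - a)\<^sup>2) = 0" "(\<Sum>v\<in>UNIV - C. (d v - b)\<^sup>2) = 0"
      unfolding W_def by (simp_all add: add_nonneg_eq_0_iff sum_nonneg)
    then have "\<forall>v\<in>C. d v = a" "\<forall>v\<in>UNIV - C. d v = b"
      by (simp_all add: sum_nonneg_eq_0_iff)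
    then show ?thesis
      using assms(5) by (intro perfect_2_coloringI[of E r C a b]) (auto simp: d_def)
  qed
  have D': "p2 * (real r - a)\<^sup>2 + \<beta> - poly [:p0, p1, p2:] a = D"
    by (simp add: D_def t_def)
  show ?thesis
    unfolding D' n t_def[symmetric] c_def[symmetric] using bound coloring by blast
qed

end
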